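(* Let $\mu$ be a Borel measure on $\mathbb{R}^n$ such that $0<\mu(B)<\infty$ for every Euclidean ball $B\subset\mathbb{R}^n$. Suppose that, for some $1\le p<\infty$ and $1<\sigma<\infty$, the triple $(\mathbb{R}^n,d_E,\mu)$ admits a weak $(p\sigma,p)$-Sobolev inequality with a (finite) constant $C_S>0$. Then $\mu$ is doubling on $(\mathbb{R}^n,d_E)$. More precisely, there exists a constant $C_D\ge 1$, depending only on $p$, $\sigma$, and $C_S$, such that $$\mu(B(y,2R))\le C_D\,\mu(B(y,R))\qquad \text{for all } y\in\mathbb{R}^n,\ R>0.$$
   Context: $d_E(x,y)=|x-y|$ is the usual Euclidean distance on $\mathbb{R}^n$, and $B(y,R)=\{x\in\mathbb{R}^n: d_E(y,x)<R\}$ is the Euclidean ball with center $y\in\mathbb{R}^n$ and radius $R>0$. For a ball $B$, $C_c^{0,1}(B)$ denotes the set of real-valued Lipschitz functions compactly supported in $B$. Definition. Let $\mu$ be a Borel measure on $(\mathbb{R}^n,d_E)$ with $0<\mu(B)<\infty$ for every Euclidean ball $B$. Given $1\le p<\infty$ and $1<\sigma<\infty$, the triple $(\mathbb{R}^n,d_E,\mu)$ admits a weak $(p\sigma,p)$-Sobolev inequality with a (finite) constant $C_S>0$ if for every Euclidean ball $B=B(y,R)\subset\mathbb{R}^n$ and every $\varphi\in C_c^{0,1}(B)$, $$\left(\frac{1}{\mu(B)}\int_B|\varphi|^{p\sigma}\,d\mu\right)^{\frac{1}{p\sigma}}\le C_S R\left(\frac{1}{\mu(B)}\int_B|\nabla\varphi|^p\,d\mu\right)^{\frac1p}+C_S\left(\frac{1}{\mu(B)}\int_B|\varphi|^p\,d\mu\right)^{\frac1p}.$$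 *)

theory Defs
  imports "HOL-Analysis.Analysis"
begin

text \<open>
  The dimension \<open>n\<close> has to be a value rather than a type, because the doubling constant must not
  depend on it. Hence \<open>\<real>\<^sup>n\<close> is the carrier of \<^const>\<open>Euclidean_space\<close> \<open>n\<close>: the sequences
  \<open>x :: nat \<Rightarrow> real\<close> with \<open>x i = 0\<close> for all \<open>i \<ge> n\<close>.
\<close>

abbreviation Rn :: "nat \<Rightarrow> (nat \<Rightarrow> real) set"
  where "Rn n \<equiv> topspace (Euclidean_space n)"

definition enorm :: "nat \<Rightarrow> (nat \<Rightarrow> real) \<Rightarrow> real"
  where "enorm n v = L2_set v {..<n}"

definition edist :: "nat \<Rightarrow> (nat \<Rightarrow> real) \<Rightarrow> (nat \<Rightarrow> real) \<Rightarrow> real"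
  where "edist n x y = enorm n (\<lambda>i. x i - y i)"

definition Rn_ball :: "nat \<Rightarrow> (nat \<Rightarrow> real) \<Rightarrow> real \<Rightarrow> (nat \<Rightarrow> real) set"
  where "Rn_ball n y R = {x \<in> Rn n. edist n y x < R}"

definition borel_measure_on_Rn :: "nat \<Rightarrow> (nat \<Rightarrow> real) measure \<Rightarrow> bool"
  where "borel_measure_on_Rn n \<mu> \<longleftrightarrow>
    space \<mu> = Rn n \<and> sets \<mu> = sigma_sets (Rn n) {U. openin (Euclidean_space n) U}"

text \<open>
  The members of \<open>C\<^sub>c\<^sup>0\<^sup>,\<^sup>1(B)\<close> are identified with their extensions by zero, which are Lipschitz
  on all of \<open>\<real>\<^sup>n\<close>.
\<close>

definition lipschitz_cpt_supp :: "nat \<Rightarrow> (nat \<Rightarrow> real) set \<Rightarrow> ((nat \<Rightarrow> real) \<Rightarrow> real) set"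
  where "lipschitz_cpt_supp n B = {\<phi>.
    (\<exists>L. \<forall>x\<in>Rn n. \<forall>y\<in>Rn n. \<bar>\<phi> x - \<phi> y\<bar> \<le> L * edist n x y) \<and>
    compactin (Euclidean_space n) (Euclidean_space n closure_of {x \<in> Rn n. \<phi> x \<noteq> 0}) \<and>
    Euclidean_space n closure_of {x \<in> Rn n. \<phi> x \<noteq> 0} \<subseteq> B}"

text \<open>
  Total (Frechet) differentiability at \<open>x\<close> with gradient \<open>v\<close>, spelled out because
  \<^typ>\<open>nat \<Rightarrow> real\<close> is not an instance of the class of normed spaces.
\<close>

definition has_gradient ::
    "nat \<Rightarrow> ((nat \<Rightarrow> real) \<Rightarrow> real) \<Rightarrow> (nat \<Rightarrow> real) \<Rightarrow> (nat \<Rightarrow> real) \<Rightarrow> bool"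
  where "has_gradient n \<phi> v x \<longleftrightarrow> v \<in> Rn n \<and>
    (\<forall>\<epsilon>>0. \<exists>\<delta>>0. \<forall>y\<in>Rn n. edist n y x < \<delta> \<longrightarrow>
      \<bar>\<phi> y - \<phi> x - (\<Sum>i<n. v i * (y i - x i))\<bar> \<le> \<epsilon> * edist n y x)"

definition gradient :: "nat \<Rightarrow> ((nat \<Rightarrow> real) \<Rightarrow> real) \<Rightarrow> (nat \<Rightarrow> real) \<Rightarrow> (nat \<Rightarrow> real)"
  where "gradient n \<phi> x = (THE v. has_gradient n \<phi> v x)"

lemma has_gradient_unique:
  assumes v: "has_gradient n \<phi> v x" and w: "has_gradient n \<phi> w x" and x: "x \<in> Rn n"
  shows "v = w"
proof -
  define u where "u = (\<lambda>i. v i - w i)"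
  define N where "N = enorm n u"
  have vR: "v \<in> Rn n" and wR: "w \<in> Rn n" using v w by (auto simp: has_gradient_def)
  have N0: "N \<ge> 0" by (simp add: N_def enorm_def)
  have N2: "(\<Sum>i<n. u i * u i) = N * N"
    unfolding N_def enorm_def L2_set_def by (simp add: power2_eq_square sum_nonneg)
  have "N = 0"
  proof (rule ccontr)
    assume "N \<noteq> 0"
    with N0 have Np: "N > 0" by simp
    define e where "e = N / 4"
    have ep: "e > 0" using Np by (simp add: e_def)
    obtain d1 where d1: "d1 > 0" "\<And>y. y \<in> Rn n \<Longrightarrow> edist n y x < d1 \<Longrightarrow>
      \<bar>\<phi> y - \<phi> x - (\<Sum>i<n. v i * (y i - x i))\<bar> \<le> e * edist n y x"
      using v ep unfolding has_gradient_def by blast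
    obtain d2 where d2: "d2 > 0" "\<And>y. y \<in> Rn n \<Longrightarrow> edist n y x < d2 \<Longrightarrow>
      \<bar>\<phi> y - \<phi> x - (\<Sum>i<n. w i * (y i - x i))\<bar> \<le> e * edist n y x"
      using w ep unfolding has_gradient_def by blast
    define t where "t = min d1 d2 / (2 * N)"
    have tp: "t > 0" using d1 d2 Np by (simp add: t_def)
    define y where "y = (\<lambda>i. x i + t * u i)"
    have yR: "y \<in> Rn n"
      using x vR wR by (simp add: y_def u_def topspace_Euclidean_space)
    have dy: "edist n y x = t * N"
      unfolding edist_def y_def N_def enorm_def using tp
      by (simp add: L2_set_right_distrib)
    have tN: "t * N = min d1 d2 / 2" using Np by (simp add: t_def)
    have "edist n y x < d1" "edist n y x < d2" using dy tN d1(1) d2(1) by auto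
    with d1(2)[OF yR] d2(2)[OF yR] have
      "\<bar>(\<Sum>i<n. v i * (y i - x i)) - (\<Sum>i<n. w i * (y i - x i))\<bar> \<le> 2 * e * (t * N)"
      using dy by (simp add: abs_if split: if_splits)
    moreover have "(\<Sum>i<n. v i * (y i - x i)) - (\<Sum>i<n. w i * (y i - x i)) = t * (N * N)"
      unfolding N2[symmetric] sum_distrib_left sum_subtractf[symmetric]
      by (intro sum.cong) (auto simp: y_def u_def algebra_simps)
    ultimately have "t * (N * N) \<le> 2 * e * (t * N)" by linarith
    then have "t * N * N \<le> t * N * (N / 2)" by (simp add: e_def mult_ac)
    with tp Np show False by simp
  qed
  then have "v i = w i" if "i < n" for i
    using that L2_set_eq_0_iff[of "{..<n}" u] by (simp add: N_def enorm_def u_def)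
  moreover have "v i = w i" if "i \<ge> n" for i
    using that vR wR by (simp add: topspace_Euclidean_space)
  ultimately show ?thesis by (metis ext not_less)
qed

text \<open>
  The measure may be singular with respect to Lebesgue measure, so Rademacher's theorem does not
  provide \<open>\<nabla>\<phi>\<close> \<open>\<mu>\<close>-almost everywhere. The inequality is required precisely for those \<open>\<phi>\<close> for
  which it is, i.e. for which the integral of \<open>|\<nabla>\<phi>|\<^sup>p\<close> against \<open>\<mu>\<close> makes sense. Any convention
  assigning values to \<open>\<nabla>\<phi>\<close> at points of non-differentiability gives an at least as strong
  condition on \<open>\<mu>\<close>.
\<close>

definition weak_sobolev ::
    "nat \<Rightarrow> (nat \<Rightarrow> real) measure \<Rightarrow> real \<Rightarrow> real \<Rightarrow> real \<Rightarrow> bool"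
  where "weak_sobolev n \<mu> p \<sigma> C \<longleftrightarrow>
    (\<forall>y\<in>Rn n. \<forall>R>0. \<forall>\<phi>\<in>lipschitz_cpt_supp n (Rn_ball n y R).
      (AE x in \<mu>. x \<in> Rn_ball n y R \<longrightarrow> (\<exists>v. has_gradient n \<phi> v x)) \<longrightarrow>
      (1 / measure \<mu> (Rn_ball n y R) *
          (LINT x:Rn_ball n y R|\<mu>. \<bar>\<phi> x\<bar> powr (p * \<sigma>))) powr (1 / (p * \<sigma>))
      \<le> C * R * (1 / measure \<mu> (Rn_ball n y R) *
          (LINT x:Rn_ball n y R|\<mu>. enorm n (gradient n \<phi> x) powr p)) powr (1 / p)
        + C * (1 / measure \<mu> (Rn_ball n y R) *
          (LINT x:Rn_ball n y R|\<mu>. \<bar>\<phi> x\<bar> powr p)) powr (1 / p))"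

definition doubling_with :: "nat \<Rightarrow> (nat \<Rightarrow> real) measure \<Rightarrow> real \<Rightarrow> bool"
  where "doubling_with n \<mu> C \<longleftrightarrow>
    (\<forall>y\<in>Rn n. \<forall>R>0. measure \<mu> (Rn_ball n y (2 * R)) \<le> C * measure \<mu> (Rn_ball n y R))"

end

theory Submission
  imports Defs
begin

text \<open>
  A Sobolev inequality gains integrability, and this gain makes the measure of concentric balls
  collapse once it is too small. Fix \<open>y\<close> and \<open>R\<close>, apply the inequality on the ball \<open>B(y, 2R)\<close>, and
  write \<open>a(r) = \<mu>(B(y, r)) / \<mu>(B(y, 2R))\<close>. Testing with a function that lives on \<open>B(y, r)\<close> and is bounded
  below on \<open>B(y, s)\<close>, where \<open>R/2 < s < r \<le> R\<close>, gives

    \<open>a(s) powr (1 / (p \<sigma>)) \<le> const (R / (r - s))\<^sup>2 a(r) powr (1 / p)\<close>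

  (lemma \<open>weak_sobolev_imp_ball_ratio\<close>), i.e. up to a constant \<open>a(s)\<close> is at most the power
  \<open>\<sigma> > 1\<close> of \<open>a(r)\<close>. Along radii decreasing geometrically from \<open>R\<close> to \<open>R/2\<close> this is De Giorgi's
  iteration: if \<open>a(R)\<close> is below a threshold \<open>c\<close> depending only on \<open>p\<close>, \<open>\<sigma>\<close> and the Sobolev constant,
  the superlinear power beats the geometric growth of the constants, and \<open>a(r) \<rightarrow> 0\<close> along the
  radii (lemma \<open>superlinear_iteration_lower_bound\<close>). But \<open>a(r) \<ge> a(R/2) > 0\<close>, because balls have
  positive measure. Hence \<open>a(R) > c\<close>, which is the doubling inequality with constant \<open>1 / c\<close>. The
  dimension never enters, since the bounds on the test functions are radial.

  The measure may charge sets that are null for Lebesgue measure, such as spheres. A piecewise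
  linear cutoff is therefore unsuitable: its gradient may fail to exist on a set of positive
  measure. The test functions used instead,
  \<open>x \<mapsto> (max 0 (r\<^sup>2 - |x - y|\<^sup>2))\<^sup>2\<close>, are differentiable everywhere. They are not constant on the
  smaller ball, but the iteration only needs a lower bound there.
\<close>

section \<open>Euclidean balls in the carrier\<close>

lemma edist_nonneg: "0 \<le> edist n x y"
  by (simp add: edist_def enorm_def)

lemma edist_commute: "edist n x y = edist n y x"
  by (simp add: edist_def enorm_def L2_set_def power2_commute)

lemma edist_triangle: "edist n x z \<le> edist n x y + edist n y z"
  using L2_set_triangle_ineq[of "\<lambda>i. x i - y i" "\<lambda>i. y i - z i" "{..<n}"]
  by (simp add: edist_def enorm_def)

lemma edist_sq: "(edist n x y)\<^sup>2 = (\<Sum>i<n. (x i - y i)\<^sup>2)"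
  by (simp add: edist_def enorm_def L2_set_def sum_nonneg)

lemma abs_diff_le_edist: "i < n \<Longrightarrow> \<bar>x i - y i\<bar> \<le> edist n x y"
  using member_le_L2_set[of "{..<n}" i "\<lambda>i. \<bar>x i - y i\<bar>"]
  by (simp add: edist_def enorm_def L2_set_def)

lemma continuous_map_edist: "continuous_map (Euclidean_space n) euclideanreal (edist n y)"
proof -
  have "continuous_map (Euclidean_space n) euclideanreal (\<lambda>x. x i)" for i
    unfolding Euclidean_space_def
    by (intro continuous_map_from_subtopology continuous_map_product_projection) auto
  then have "continuous_map (Euclidean_space n) euclideanreal (\<lambda>x. \<Sum>i<n. (y i - x i)\<^sup>2)"
    by (intro continuous_intros) auto
  then have "continuous_map (Euclidean_space n) euclideanreal (sqrt \<circ> (\<lambda>x. \<Sum>i<n. (y i - x i)\<^sup>2))"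
    by (rule continuous_map_compose) (simp add: continuous_on_real_sqrt)
  then show ?thesis
    by (simp add: o_def edist_def[abs_def] enorm_def L2_set_def)
qed

lemma openin_Rn_ball: "openin (Euclidean_space n) (Rn_ball n y r)"
  using openin_continuous_map_preimage[OF continuous_map_edist, of "{..<r}" n y]
  by (simp add: Rn_ball_def)

text \<open>
  \<^const>\<open>Euclidean_space\<close> carries the topology of pointwise convergence, so compactness comes from
  Tychonoff's theorem: the ball is a closed subset of a product of compact intervals.
\<close>

lemma compactin_closed_Rn_ball:
  "compactin (Euclidean_space n) {x \<in> Rn n. edist n y x \<le> r}"
proof -
  define Q where "Q = PiE UNIV (\<lambda>i. if i < n then {y i - r..y i + r} else {0})"
  have Q: "Q \<subseteq> Rn n"
  proof
    fix x assume x: "x \<in> Q"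
    have "x i = 0" if "n \<le> i" for i
      using PiE_mem[OF x[unfolded Q_def] UNIV_I, of i] that by simp
    then show "x \<in> Rn n" by (simp add: topspace_Euclidean_space)
  qed
  have "compactin (powertop_real UNIV) Q"
    unfolding Q_def by (subst compactin_PiE) auto
  then have "compactin (Euclidean_space n) Q"
    using Q unfolding Euclidean_space_def by (simp add: compactin_subtopology)
  moreover have "{x \<in> Rn n. edist n y x \<le> r} \<subseteq> Q"
  proof
    fix x assume x: "x \<in> {x \<in> Rn n. edist n y x \<le> r}"
    have "\<bar>y i - x i\<bar> \<le> r" if "i < n" for i
      using abs_diff_le_edist[OF that, of y x] x by simp
    then have "x i \<in> (if i < n then {y i - r..y i + r} else {0})" for i
      using x by (cases "i < n") (force simp: topspace_Euclidean_space abs_le_iff)+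
    then show "x \<in> Q" by (simp add: Q_def PiE_iff)
  qed
  moreover have "closedin (Euclidean_space n) {x \<in> Rn n. edist n y x \<le> r}"
    using closedin_continuous_map_preimage[OF continuous_map_edist, of "{..r}" n y] by simp
  ultimately show ?thesis
    by (rule closed_compactin)
qed

section \<open>The test functions\<close>

definition bump :: "nat \<Rightarrow> (nat \<Rightarrow> real) \<Rightarrow> real \<Rightarrow> (nat \<Rightarrow> real) \<Rightarrow> real"
  where "bump n y r x = (max 0 (r\<^sup>2 - (edist n y x)\<^sup>2))\<^sup>2"

definition bump_grad :: "nat \<Rightarrow> (nat \<Rightarrow> real) \<Rightarrow> real \<Rightarrow> (nat \<Rightarrow> real) \<Rightarrow> (nat \<Rightarrow> real)"
  where "bump_grad n y r x =
    (\<lambda>i. if i < n then - 4 * max 0 (r\<^sup>2 - (edist n y x)\<^sup>2) * (x i - y i) else 0)"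

text \<open>
  The square of the positive part is continuously differentiable with 2-Lipschitz derivative, so its
  first-order Taylor remainder is quadratic. This makes the test functions differentiable even on
  the sphere where they start to vanish.
\<close>

lemma square_positive_part_Taylor:
  fixes s t :: real
  shows "\<bar>(max 0 t)\<^sup>2 - (max 0 s)\<^sup>2 - 2 * max 0 s * (t - s)\<bar> \<le> (t - s)\<^sup>2"
proof (cases "0 \<le> s"; cases "0 \<le> t")
  assume s: "0 \<le> s" and t: "\<not> 0 \<le> t"
  have "s * t \<le> 0" using s t by (intro mult_nonneg_nonpos) auto
  moreover have "0 \<le> s * s" by simp
  ultimately have "\<bar>s * s - 2 * (s * t)\<bar> = s * s - 2 * (s * t)" by linarith
  with s t show ?thesis by (simp add: max_def power2_eq_square algebra_simps)
next
  assume s: "\<not> 0 \<le> s" and t: "0 \<le> t"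
  have "s * t \<le> 0" using s t by (intro mult_nonpos_nonneg) auto
  then have "t * t \<le> t * t - 2 * (s * t) + s * s"
    using zero_le_square[of s] by linarith
  with s t show ?thesis by (simp add: max_def power2_eq_square algebra_simps)
next
  assume st: "0 \<le> s" "0 \<le> t"
  have "t\<^sup>2 - s\<^sup>2 - 2 * s * (t - s) = (t - s)\<^sup>2"
    by (simp add: power2_eq_square algebra_simps)
  with st show ?thesis by (simp add: max_def)
next
  assume "\<not> 0 \<le> s" "\<not> 0 \<le> t"
  then show ?thesis by (simp add: max_def)
qed

text \<open>
  The chain rule for \<open>(max 0 _)\<^sup>2\<close> after the quadratic polynomial \<open>x \<mapsto> r\<^sup>2 - |x - y|\<^sup>2\<close>, with a
  remainder that is explicitly quadratic in \<open>|z - x|\<close>.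
\<close>

lemma has_gradient_bump: "has_gradient n (bump n y r) (bump_grad n y r x) x"
  unfolding has_gradient_def
proof (intro conjI allI impI)
  show "bump_grad n y r x \<in> Rn n"
    by (simp add: bump_grad_def topspace_Euclidean_space)
next
  fix \<epsilon> :: real assume \<epsilon>: "\<epsilon> > 0"
  define q where "q = edist n y x"
  define u where "u = max 0 (r\<^sup>2 - q\<^sup>2)"
  define M where "M = (2 * q + 1)\<^sup>2 + 2 * u + 1"
  have q: "0 \<le> q" and u: "0 \<le> u" by (auto simp: q_def u_def edist_nonneg)
  have M: "M > 0" using u by (simp add: M_def add_nonneg_pos)
  define \<delta> where "\<delta> = min 1 (\<epsilon> / M)"
  have \<delta>: "\<delta> > 0" using \<epsilon> M by (simp add: \<delta>_def)
  have "\<bar>bump n y r z - bump n y r x - (\<Sum>i<n. bump_grad n y r x i * (z i - x i))\<bar>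
      \<le> \<epsilon> * edist n z x" if z: "edist n z x < \<delta>" for z
  proof -
    define d where "d = edist n z x"
    define q' where "q' = edist n y z"
    have d: "0 \<le> d" "d < 1" "d \<le> \<epsilon> / M" using z by (auto simp: d_def \<delta>_def edist_nonneg)
    have q': "0 \<le> q'" by (simp add: q'_def edist_nonneg)
    have "q' \<le> q + d" "q \<le> q' + d"
      using edist_triangle[of n y z x] edist_triangle[of n y x z]
      by (auto simp: q_def q'_def d_def edist_commute)
    then have qq: "\<bar>q' - q\<bar> \<le> d" "q' + q \<le> 2 * q + 1" using d by auto
    \<comment> \<open>The linear part of \<open>|z - y|\<^sup>2 - |x - y|\<^sup>2\<close> is what the gradient sees; the remaining
      \<open>d\<^sup>2\<close> goes into the error.\<close>
    have expand: "q'\<^sup>2 - q\<^sup>2 = (\<Sum>i<n. 2 * (x i - y i) * (z i - x i)) + d\<^sup>2"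
      unfolding q_def q'_def d_def edist_sq sum_subtractf[symmetric] sum.distrib[symmetric]
      by (intro sum.cong) (auto simp: power2_eq_square algebra_simps)
    have "(\<Sum>i<n. bump_grad n y r x i * (z i - x i))
        = - 2 * u * (\<Sum>i<n. 2 * (x i - y i) * (z i - x i))"
      unfolding sum_distrib_left
      by (intro sum.cong) (auto simp: bump_grad_def u_def q_def)
    also have "\<dots> = 2 * u * ((r\<^sup>2 - q'\<^sup>2) - (r\<^sup>2 - q\<^sup>2)) + 2 * u * d\<^sup>2"
      using expand by (simp add: algebra_simps)
    finally have lin: "(\<Sum>i<n. bump_grad n y r x i * (z i - x i)) = \<dots>" .
    have "\<bar>bump n y r z - bump n y r x - 2 * u * ((r\<^sup>2 - q'\<^sup>2) - (r\<^sup>2 - q\<^sup>2))\<bar>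
        \<le> ((r\<^sup>2 - q'\<^sup>2) - (r\<^sup>2 - q\<^sup>2))\<^sup>2"
      unfolding bump_def u_def q_def[symmetric] q'_def[symmetric]
      by (rule square_positive_part_Taylor)
    also have "\<dots> = (\<bar>q' - q\<bar> * (q' + q))\<^sup>2"
      by (simp add: power_mult_distrib) (simp add: power2_eq_square algebra_simps)
    also have "\<dots> \<le> (d * (2 * q + 1))\<^sup>2"
      using qq q q' d by (intro power_mono mult_mono) auto
    finally have "\<bar>bump n y r z - bump n y r x - 2 * u * ((r\<^sup>2 - q'\<^sup>2) - (r\<^sup>2 - q\<^sup>2))\<bar>
        \<le> d\<^sup>2 * (2 * q + 1)\<^sup>2" by (simp add: power_mult_distrib)
    moreover have "0 \<le> 2 * u * d\<^sup>2" using u by simp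
    ultimately have "\<bar>bump n y r z - bump n y r x - (\<Sum>i<n. bump_grad n y r x i * (z i - x i))\<bar>
        \<le> d\<^sup>2 * (2 * q + 1)\<^sup>2 + 2 * u * d\<^sup>2"
      unfolding lin by linarith
    also have "\<dots> \<le> d\<^sup>2 * M" by (simp add: M_def algebra_simps)
    also have "\<dots> = (d * M) * d" by (simp add: power2_eq_square)
    also have "\<dots> \<le> \<epsilon> * d"
      using d M by (intro mult_right_mono) (auto simp: field_simps)
    finally show ?thesis by (simp add: d_def)
  qed
  with \<delta> show "\<exists>\<delta>>0. \<forall>z\<in>Rn n. edist n z x < \<delta> \<longrightarrow>
      \<bar>bump n y r z - bump n y r x - (\<Sum>i<n. bump_grad n y r x i * (z i - x i))\<bar>
      \<le> \<epsilon> * edist n z x" by blast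
qed

lemma gradient_bump: "x \<in> Rn n \<Longrightarrow> gradient n (bump n y r) x = bump_grad n y r x"
  unfolding gradient_def
  by (rule the_equality) (auto intro: has_gradient_bump has_gradient_unique)

lemma enorm_bump_grad:
  "enorm n (bump_grad n y r x) = 4 * max 0 (r\<^sup>2 - (edist n y x)\<^sup>2) * edist n y x"
proof -
  have "enorm n (bump_grad n y r x) =
      L2_set (\<lambda>i. 4 * max 0 (r\<^sup>2 - (edist n y x)\<^sup>2) * (y i - x i)) {..<n}"
    unfolding enorm_def by (intro L2_set_cong) (auto simp: bump_grad_def algebra_simps)
  also have "\<dots> = 4 * max 0 (r\<^sup>2 - (edist n y x)\<^sup>2) * edist n y x"
    unfolding edist_def[of n y x] enorm_def by (subst L2_set_right_distrib) auto
  finally show ?thesis .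
qed

lemma bump_eq_0: "0 \<le> r \<Longrightarrow> r \<le> edist n y x \<Longrightarrow> bump n y r x = 0"
  using power_mono[of r "edist n y x" 2] by (simp add: bump_def)

lemma bump_nonneg: "0 \<le> bump n y r x"
  by (simp add: bump_def)

lemma bump_le: "bump n y r x \<le> r ^ 4"
proof -
  have "max 0 (r\<^sup>2 - (edist n y x)\<^sup>2) \<le> r\<^sup>2" by simp
  then have "bump n y r x \<le> (r\<^sup>2)\<^sup>2" unfolding bump_def by (intro power_mono) auto
  then show ?thesis by simp
qed

lemma bump_ge:
  assumes "0 \<le> s" "s \<le> r" "edist n y x \<le> s"
  shows "(r\<^sup>2 - s\<^sup>2)\<^sup>2 \<le> bump n y r x"
proof -
  have "(edist n y x)\<^sup>2 \<le> s\<^sup>2" "s\<^sup>2 \<le> r\<^sup>2"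
    using assms by (auto intro!: power_mono simp: edist_nonneg)
  then show ?thesis unfolding bump_def by (intro power_mono) auto
qed

lemma enorm_bump_grad_le:
  assumes "0 \<le> r"
  shows "enorm n (bump_grad n y r x) \<le> 4 * r ^ 3"
proof (cases "edist n y x \<le> r")
  case True
  then have "4 * max 0 (r\<^sup>2 - (edist n y x)\<^sup>2) * edist n y x \<le> 4 * r\<^sup>2 * r"
    using assms by (intro mult_mono) (auto simp: edist_nonneg)
  then show ?thesis by (simp add: enorm_bump_grad power2_eq_square power3_eq_cube)
next
  case False
  then have "r\<^sup>2 \<le> (edist n y x)\<^sup>2" using assms by (intro power_mono) auto
  then show ?thesis using assms by (simp add: enorm_bump_grad)
qed

lemma enorm_bump_grad_eq_0: "0 \<le> r \<Longrightarrow> r \<le> edist n y x \<Longrightarrow> enorm n (bump_grad n y r x) = 0"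
  using power_mono[of r "edist n y x" 2] by (simp add: enorm_bump_grad)

lemma abs_diff_power2_le:
  fixes a b c :: real
  assumes "0 \<le> a" "a \<le> c" "0 \<le> b" "b \<le> c"
  shows "\<bar>a\<^sup>2 - b\<^sup>2\<bar> \<le> 2 * c * \<bar>a - b\<bar>"
proof -
  have "\<bar>a\<^sup>2 - b\<^sup>2\<bar> = (a + b) * \<bar>a - b\<bar>"
    using assms by (simp add: square_diff_square_factored power2_eq_square abs_mult)
  also have "\<dots> \<le> 2 * c * \<bar>a - b\<bar>" using assms by (intro mult_right_mono) auto
  finally show ?thesis .
qed

text \<open>
  On \<open>B(y, r)\<close> the function is a polynomial in the distance to \<open>y\<close>. Truncating that distance at
  \<open>r\<close> makes the polynomial formula valid everywhere, so that only Lipschitz bounds for squares of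
  numbers in bounded intervals are needed.
\<close>

lemma bump_Lipschitz:
  assumes "0 \<le> r"
  shows "\<bar>bump n y r x - bump n y r z\<bar> \<le> 4 * r ^ 3 * edist n x z"
proof -
  define m where "m = (\<lambda>x. min r (edist n y x))"
  have m: "0 \<le> m x" "m x \<le> r" for x using assms by (auto simp: m_def edist_nonneg)
  have b: "bump n y r x = (r\<^sup>2 - (m x)\<^sup>2)\<^sup>2" for x
  proof (cases "edist n y x \<le> r")
    case True
    then have "(edist n y x)\<^sup>2 \<le> r\<^sup>2" by (intro power_mono) (auto simp: edist_nonneg)
    with True show ?thesis by (simp add: bump_def m_def)
  next
    case False
    then show ?thesis using bump_eq_0[OF assms, of n y x] by (simp add: m_def)
  qed
  have m2: "(m x)\<^sup>2 \<le> r\<^sup>2" for x using m by (intro power_mono) auto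
  have "\<bar>bump n y r x - bump n y r z\<bar> \<le> 2 * r\<^sup>2 * \<bar>(r\<^sup>2 - (m x)\<^sup>2) - (r\<^sup>2 - (m z)\<^sup>2)\<bar>"
    unfolding b using m2 by (intro abs_diff_power2_le) auto
  also have "\<dots> = 2 * r\<^sup>2 * \<bar>(m x)\<^sup>2 - (m z)\<^sup>2\<bar>" by (simp add: abs_minus_commute)
  also have "\<dots> \<le> 2 * r\<^sup>2 * (2 * r * \<bar>m x - m z\<bar>)"
    using m by (intro mult_left_mono abs_diff_power2_le) auto
  also have "\<dots> \<le> 2 * r\<^sup>2 * (2 * r * edist n x z)"
  proof -
    have "\<bar>m x - m z\<bar> \<le> edist n x z"
      using edist_triangle[of n y z x] edist_triangle[of n y x z]
      by (auto simp: m_def edist_commute[of n z x] min_def)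
    then show ?thesis using assms by (intro mult_left_mono) auto
  qed
  finally show ?thesis by (simp add: power2_eq_square power3_eq_cube)
qed

lemma bump_in_lipschitz_cpt_supp:
  assumes "0 \<le> r" "r < S"
  shows "bump n y r \<in> lipschitz_cpt_supp n (Rn_ball n y S)"
proof -
  define K where "K = {x \<in> Rn n. edist n y x \<le> r}"
  define T where "T = Euclidean_space n closure_of {x \<in> Rn n. bump n y r x \<noteq> 0}"
  have "closedin (Euclidean_space n) K"
    using closedin_continuous_map_preimage[OF continuous_map_edist, of "{..r}" n y]
    by (simp add: K_def)
  moreover have "{x \<in> Rn n. bump n y r x \<noteq> 0} \<subseteq> K"
    using bump_eq_0[OF assms(1), of n y] by (force simp: K_def)
  ultimately have TK: "T \<subseteq> K"
    unfolding T_def by (intro closure_of_minimal)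
  have "compactin (Euclidean_space n) T"
    using closed_compactin[OF compactin_closed_Rn_ball TK[unfolded K_def]] by (simp add: T_def)
  moreover have "T \<subseteq> Rn_ball n y S"
    using TK assms by (auto simp: K_def Rn_ball_def)
  moreover have "\<exists>L. \<forall>x\<in>Rn n. \<forall>z\<in>Rn n. \<bar>bump n y r x - bump n y r z\<bar> \<le> L * edist n x z"
    using bump_Lipschitz[OF assms(1), of n y] by (intro exI[of _ "4 * r ^ 3"] ballI)
  ultimately show ?thesis
    unfolding lipschitz_cpt_supp_def T_def mem_Collect_eq by (intro conjI)
qed

lemma borel_measurable_bump:
  assumes "borel_measure_on_Rn n \<mu>"
  shows "bump n y r \<in> borel_measurable \<mu>"
proof -
  have "edist n y \<in> borel_measurable \<mu>"
  proof (rule borel_measurableI)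
    fix U :: "real set" assume "open U"
    then have "openin (Euclidean_space n) {x \<in> Rn n. edist n y x \<in> U}"
      using openin_continuous_map_preimage[OF continuous_map_edist, of U n y] by simp
    moreover have "edist n y -` U \<inter> space \<mu> = {x \<in> Rn n. edist n y x \<in> U}"
      using assms by (auto simp: borel_measure_on_Rn_def)
    ultimately show "edist n y -` U \<inter> space \<mu> \<in> sets \<mu>"
      using assms by (simp add: borel_measure_on_Rn_def sigma_sets.Basic)
  qed
  then show ?thesis unfolding bump_def[abs_def] by measurable
qed

lemma sets_Rn_ball:
  assumes "borel_measure_on_Rn n \<mu>"
  shows "Rn_ball n y r \<in> sets \<mu>"
  using assms openin_Rn_ball by (simp add: borel_measure_on_Rn_def sigma_sets.Basic)

section \<open>Consequence of the Sobolev inequality for concentric balls\<close>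

text \<open>
  A non-integrable function has integral 0, so the bound holds for arbitrary \<open>f\<close> and applies
  directly to the norm of a gradient.
\<close>

lemma set_lebesgue_integral_le_const_measure:
  fixes f :: "'a \<Rightarrow> real"
  assumes "B \<in> sets M" "emeasure M B < \<infinity>" "0 \<le> c"
    and "\<And>x. x \<in> space M \<Longrightarrow> x \<in> A \<Longrightarrow> f x \<le> (if x \<in> B then c else 0)"
  shows "(LINT x:A|M. f x) \<le> c * measure M B"
proof -
  have "integrable M (\<lambda>x. c * indicator B x)"
    using assms by (intro integrable_mult_right integrable_real_indicator) auto
  then have "(LINT x:A|M. f x) \<le> (LINT x|M. c * indicator B x)"
    unfolding set_lebesgue_integral_def
  proof (rule integral_mono')
    show "indicator A x *\<^sub>R f x \<le> c * indicator B x" if "x \<in> space M" for x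
      using assms(3) assms(4)[OF that] by (auto simp: indicator_def)
  qed (use assms(3) in auto)
  also have "\<dots> = c * measure M B" using assms by simp
  finally show ?thesis .
qed

text \<open>
  The Sobolev inequality on \<open>B(y, S)\<close> for the test function of radius \<open>r\<close>. That function is at least
  \<open>(r\<^sup>2 - s\<^sup>2)\<^sup>2\<close> on \<open>B(y, s)\<close>; it is at most \<open>r\<^sup>4\<close>, its gradient at most \<open>4 r\<^sup>3\<close>, and both
  vanish outside \<open>B(y, r)\<close>. Thus all three averages reduce to measures of balls.
\<close>

lemma weak_sobolev_imp_ball_ratio:
  fixes \<mu> :: "(nat \<Rightarrow> real) measure"
  assumes p: "1 \<le> p" and \<sigma>: "1 < \<sigma>" and C: "0 < C"
    and bor: "borel_measure_on_Rn n \<mu>"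
    and fin: "\<And>r. 0 < r \<Longrightarrow> emeasure \<mu> (Rn_ball n y r) < \<infinity>"
    and ws: "weak_sobolev n \<mu> p \<sigma> C"
    and y: "y \<in> Rn n" and s: "0 < s" "s < r" and r: "r < S"
  shows "(measure \<mu> (Rn_ball n y s) / measure \<mu> (Rn_ball n y S)) powr (1 / (p * \<sigma>)) * (r\<^sup>2 - s\<^sup>2)\<^sup>2
    \<le> C * (4 * S * r ^ 3 + r ^ 4) *
       (measure \<mu> (Rn_ball n y r) / measure \<mu> (Rn_ball n y S)) powr (1 / p)"
proof -
  define B where "B = Rn_ball n y S"
  define m where "m = (\<lambda>r. measure \<mu> (Rn_ball n y r))"
  define \<phi> where "\<phi> = bump n y r"
  define w where "w = (r\<^sup>2 - s\<^sup>2)\<^sup>2"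
  have pos: "0 < r" "0 < S" "0 < p" "0 < p * \<sigma>" using s r p \<sigma> by auto
  have m0: "0 \<le> m t" for t by (simp add: m_def)
  have w0: "0 \<le> w" by (simp add: w_def)
  have sp: "space \<mu> = Rn n" using bor by (simp add: borel_measure_on_Rn_def)
  have sets: "Rn_ball n y t \<in> sets \<mu>" for t using bor by (rule sets_Rn_ball)
  have sub: "Rn_ball n y s \<subseteq> B" using s r by (auto simp: B_def Rn_ball_def)
  have "\<phi> \<in> lipschitz_cpt_supp n (Rn_ball n y S)"
    unfolding \<phi>_def using pos r by (intro bump_in_lipschitz_cpt_supp) auto
  moreover have "AE x in \<mu>. x \<in> Rn_ball n y S \<longrightarrow> (\<exists>v. has_gradient n \<phi> v x)"
    unfolding \<phi>_def using has_gradient_bump by blast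
  ultimately have sob: "(1 / m S * (LINT x:B|\<mu>. \<bar>\<phi> x\<bar> powr (p * \<sigma>))) powr (1 / (p * \<sigma>))
      \<le> C * S * (1 / m S * (LINT x:B|\<mu>. enorm n (gradient n \<phi> x) powr p)) powr (1 / p)
        + C * (1 / m S * (LINT x:B|\<mu>. \<bar>\<phi> x\<bar> powr p)) powr (1 / p)"
    using ws y pos unfolding weak_sobolev_def m_def B_def by blast
  \<comment> \<open>The normalised \<open>L\<^sup>e\<close> norm of a function equal to \<open>c\<close> on \<open>B(y, t)\<close> and 0 elsewhere.\<close>
  have pull: "(1 / m S * (c powr e * m t)) powr (1 / e) = c * (m t / m S) powr (1 / e)"
    if "0 \<le> c" "0 < e" for c e t
  proof -
    have "(1 / m S * (c powr e * m t)) powr (1 / e) = (c powr e) powr (1 / e) * (m t / m S) powr (1 / e)"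
      using m0 by (subst powr_mult[symmetric]) (auto simp: mult_ac)
    also have "(c powr e) powr (1 / e) = c" using that by (simp add: powr_powr)
    finally show ?thesis .
  qed
  have "w powr (p * \<sigma>) * m s \<le> (LINT x:B|\<mu>. \<bar>\<phi> x\<bar> powr (p * \<sigma>))"
  proof -
    have meas: "\<phi> \<in> borel_measurable \<mu>" unfolding \<phi>_def by (rule borel_measurable_bump[OF bor])
    have "integrable \<mu> (\<lambda>x. (r ^ 4) powr (p * \<sigma>) * indicator B x)"
      using sets fin pos unfolding B_def by (intro integrable_mult_right integrable_real_indicator) auto
    then have int: "integrable \<mu> (\<lambda>x. indicator B x *\<^sub>R \<bar>\<phi> x\<bar> powr (p * \<sigma>))"
    proof (rule Bochner_Integration.integrable_bound)
      show "(\<lambda>x. indicator B x *\<^sub>R \<bar>\<phi> x\<bar> powr (p * \<sigma>)) \<in> borel_measurable \<mu>"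
        using meas sets unfolding B_def by measurable
      have "\<bar>\<phi> x\<bar> powr (p * \<sigma>) \<le> (r ^ 4) powr (p * \<sigma>)" for x
        using pos bump_le[of n y r x] bump_nonneg[of n y r x]
        by (intro powr_mono2) (auto simp: \<phi>_def)
      then show "AE x in \<mu>. norm (indicator B x *\<^sub>R \<bar>\<phi> x\<bar> powr (p * \<sigma>))
          \<le> norm ((r ^ 4) powr (p * \<sigma>) * indicator B x)"
        by (auto simp: indicator_def)
    qed
    have "w powr (p * \<sigma>) * m s = (LINT x|\<mu>. w powr (p * \<sigma>) * indicator (Rn_ball n y s) x)"
      using sets fin s by (simp add: m_def)
    also have "\<dots> \<le> (LINT x|\<mu>. indicator B x *\<^sub>R \<bar>\<phi> x\<bar> powr (p * \<sigma>))"
    proof (rule integral_mono'[OF int])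
      fix x assume "x \<in> space \<mu>"
      show "w powr (p * \<sigma>) * indicator (Rn_ball n y s) x \<le> indicator B x *\<^sub>R \<bar>\<phi> x\<bar> powr (p * \<sigma>)"
      proof (cases "x \<in> Rn_ball n y s")
        case True
        then have "w \<le> \<phi> x"
          unfolding w_def \<phi>_def using s by (intro bump_ge) (auto simp: Rn_ball_def)
        then have "w powr (p * \<sigma>) \<le> \<bar>\<phi> x\<bar> powr (p * \<sigma>)"
          using w0 pos by (intro powr_mono2) auto
        with True sub show ?thesis by (auto simp: indicator_def)
      qed (auto simp: indicator_def)
    qed (auto simp: indicator_def)
    finally show ?thesis by (simp add: set_lebesgue_integral_def)
  qed
  then have "(1 / m S * (w powr (p * \<sigma>) * m s)) powr (1 / (p * \<sigma>))
      \<le> (1 / m S * (LINT x:B|\<mu>. \<bar>\<phi> x\<bar> powr (p * \<sigma>))) powr (1 / (p * \<sigma>))"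
    using m0 w0 pos by (intro powr_mono2 mult_left_mono mult_nonneg_nonneg) auto
  moreover have "(1 / m S * (LINT x:B|\<mu>. enorm n (gradient n \<phi> x) powr p)) powr (1 / p)
      \<le> (1 / m S * ((4 * r ^ 3) powr p * m r)) powr (1 / p)"
  proof -
    have "(LINT x:B|\<mu>. enorm n (gradient n \<phi> x) powr p) \<le> (4 * r ^ 3) powr p * m r"
      unfolding m_def
    proof (rule set_lebesgue_integral_le_const_measure)
      fix x assume "x \<in> space \<mu>" "x \<in> B"
      then have x: "x \<in> Rn n" by (simp add: sp)
      show "enorm n (gradient n \<phi> x) powr p \<le> (if x \<in> Rn_ball n y r then (4 * r ^ 3) powr p else 0)"
      proof (cases "x \<in> Rn_ball n y r")
        case True
        then show ?thesis
          using pos x enorm_bump_grad_le[of r n y x]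
          by (auto simp: \<phi>_def gradient_bump enorm_def intro!: powr_mono2)
      next
        case False
        then show ?thesis
          using pos x enorm_bump_grad_eq_0[of r n y x]
          by (auto simp: \<phi>_def gradient_bump Rn_ball_def)
      qed
    qed (use sets fin pos in auto)
    moreover have "0 \<le> (LINT x:B|\<mu>. enorm n (gradient n \<phi> x) powr p)"
      unfolding set_lebesgue_integral_def by (intro Bochner_Integration.integral_nonneg) auto
    ultimately show ?thesis
      using m0 pos by (intro powr_mono2 mult_left_mono mult_nonneg_nonneg) auto
  qed
  moreover have "(1 / m S * (LINT x:B|\<mu>. \<bar>\<phi> x\<bar> powr p)) powr (1 / p)
      \<le> (1 / m S * ((r ^ 4) powr p * m r)) powr (1 / p)"
  proof -
    have "(LINT x:B|\<mu>. \<bar>\<phi> x\<bar> powr p) \<le> (r ^ 4) powr p * m r"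
      unfolding m_def
    proof (rule set_lebesgue_integral_le_const_measure)
      fix x assume "x \<in> space \<mu>" "x \<in> B"
      then have x: "x \<in> Rn n" by (simp add: sp)
      show "\<bar>\<phi> x\<bar> powr p \<le> (if x \<in> Rn_ball n y r then (r ^ 4) powr p else 0)"
      proof (cases "x \<in> Rn_ball n y r")
        case True
        then show ?thesis
          using pos bump_le[of n y r x] bump_nonneg[of n y r x]
          by (auto simp: \<phi>_def intro!: powr_mono2)
      next
        case False
        then show ?thesis
          using pos x bump_eq_0[of r n y x] by (auto simp: \<phi>_def Rn_ball_def)
      qed
    qed (use sets fin pos in auto)
    moreover have "0 \<le> (LINT x:B|\<mu>. \<bar>\<phi> x\<bar> powr p)"
      unfolding set_lebesgue_integral_def by (intro Bochner_Integration.integral_nonneg) auto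
    ultimately show ?thesis
      using m0 pos by (intro powr_mono2 mult_left_mono mult_nonneg_nonneg) auto
  qed
  ultimately have "w * (m s / m S) powr (1 / (p * \<sigma>))
      \<le> C * S * (4 * r ^ 3 * (m r / m S) powr (1 / p)) + C * (r ^ 4 * (m r / m S) powr (1 / p))"
  proof -
    assume lhs: "(1 / m S * (w powr (p * \<sigma>) * m s)) powr (1 / (p * \<sigma>))
        \<le> (1 / m S * (LINT x:B|\<mu>. \<bar>\<phi> x\<bar> powr (p * \<sigma>))) powr (1 / (p * \<sigma>))"
      and grad: "(1 / m S * (LINT x:B|\<mu>. enorm n (gradient n \<phi> x) powr p)) powr (1 / p)
        \<le> (1 / m S * ((4 * r ^ 3) powr p * m r)) powr (1 / p)"
      and self: "(1 / m S * (LINT x:B|\<mu>. \<bar>\<phi> x\<bar> powr p)) powr (1 / p)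
        \<le> (1 / m S * ((r ^ 4) powr p * m r)) powr (1 / p)"
    have "C * S * (1 / m S * (LINT x:B|\<mu>. enorm n (gradient n \<phi> x) powr p)) powr (1 / p)
          + C * (1 / m S * (LINT x:B|\<mu>. \<bar>\<phi> x\<bar> powr p)) powr (1 / p)
        \<le> C * S * (1 / m S * ((4 * r ^ 3) powr p * m r)) powr (1 / p)
          + C * (1 / m S * ((r ^ 4) powr p * m r)) powr (1 / p)"
      using grad self C pos by (intro add_mono mult_left_mono) auto
    also have "\<dots> = C * S * (4 * r ^ 3 * (m r / m S) powr (1 / p)) + C * (r ^ 4 * (m r / m S) powr (1 / p))"
      using pos by (simp only: pull[of "4 * r ^ 3" p r] pull[of "r ^ 4" p r] zero_le_mult_iff
          zero_le_power less_imp_le zero_le_numeral simp_thms)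
    finally show ?thesis
      using lhs sob pull[OF w0 pos(4), of s] by linarith
  qed
  then show ?thesis by (simp add: m_def w_def algebra_simps)
qed

section \<open>De Giorgi's iteration and doubling\<close>

text \<open>
  With \<open>\<theta> = 1 / (\<sigma> - 1)\<close>, a starting value below the threshold forces
  \<open>a j \<le> a 0 * b powr (- \<theta> j)\<close>. The rate \<open>\<theta>\<close> is the one for which the gain \<open>b powr (- \<theta> (\<sigma> - 1) j)\<close>
  from the superlinear power cancels the factor \<open>b ^ j\<close>; the threshold is the one for which the
  induction step then leaves exactly one further factor \<open>b powr (- \<theta>)\<close>. So the sequence would tend to 0,
  which a positive lower bound excludes.
\<close>

lemma superlinear_iteration_lower_bound:
  fixes a :: "nat \<Rightarrow> real"
  assumes A: "0 < A" and b: "1 < b" and \<sigma>: "1 < \<sigma>" and m: "0 < m"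
    and low: "\<And>j. m \<le> a j"
    and step: "\<And>j. a (Suc j) \<le> A * b ^ j * a j powr \<sigma>"
  shows "A powr (- 1 / (\<sigma> - 1)) * b powr (- 1 / (\<sigma> - 1)\<^sup>2) < a 0"
proof (rule ccontr)
  assume "\<not> ?thesis"
  then have a0: "a 0 \<le> A powr (- 1 / (\<sigma> - 1)) * b powr (- 1 / (\<sigma> - 1)\<^sup>2)"
    by (simp only: not_less)
  define \<theta> where "\<theta> = 1 / (\<sigma> - 1)"
  have \<theta>: "\<theta> > 0" "\<theta> * \<sigma> = \<theta> + 1" using \<sigma> by (auto simp: \<theta>_def field_simps)
  have apos: "0 < a j" for j using m low[of j] by linarith
  have "a 0 powr (\<sigma> - 1)
      \<le> (A powr (- 1 / (\<sigma> - 1)) * b powr (- 1 / (\<sigma> - 1)\<^sup>2)) powr (\<sigma> - 1)"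
    using a0 apos[of 0] \<sigma> by (intro powr_mono2) auto
  also have "\<dots> = A powr (- 1) * b powr (- \<theta>)"
    using \<sigma> A b by (simp add: powr_mult powr_powr \<theta>_def power2_eq_square)
  also have "\<dots> = b powr (- \<theta>) / A"
    using A by (simp add: powr_minus_divide)
  finally have "A * a 0 powr (\<sigma> - 1) \<le> b powr (- \<theta>)"
    using A by (simp only: pos_le_divide_eq mult.commute)
  then have start: "A * a 0 powr \<sigma> \<le> b powr (- \<theta>) * a 0"
    using apos[of 0] by (simp add: powr_diff field_simps)
  have decay: "a j \<le> a 0 * b powr (- \<theta> * real j)" for j
  proof (induction j)
    case 0
    then show ?case using b by simp
  next
    case (Suc j)
    have "a (Suc j) \<le> A * b ^ j * a j powr \<sigma>" by (rule step)
    also have "\<dots> \<le> A * b ^ j * (a 0 * b powr (- \<theta> * real j)) powr \<sigma>"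
      using A b \<sigma> apos[of j] Suc by (intro mult_left_mono powr_mono2) auto
    also have "\<dots> = A * a 0 powr \<sigma> * (b powr real j * b powr (- (\<theta> * \<sigma>) * real j))"
      using apos[of 0] b by (simp add: powr_mult powr_powr powr_realpow mult_ac)
    also have "\<dots> = A * a 0 powr \<sigma> * b powr (- \<theta> * real j)"
      unfolding \<theta>(2) powr_add[symmetric] by (simp add: algebra_simps)
    also have "\<dots> \<le> b powr (- \<theta>) * a 0 * b powr (- \<theta> * real j)"
      using start by (intro mult_right_mono) auto
    also have "\<dots> = a 0 * b powr (- \<theta> * real (Suc j))"
    proof -
      have "- \<theta> * real (Suc j) = - \<theta> + - \<theta> * real j" by (simp add: algebra_simps)
      then show ?thesis by (simp only: powr_add mult_ac)
    qed
    finally show ?case .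
  qed
  have "(\<lambda>j. (b powr (- \<theta>)) ^ j) \<longlonglongrightarrow> 0"
    using b \<theta> by (intro LIMSEQ_realpow_zero) (auto simp: powr_less_one)
  moreover have "(b powr (- \<theta>)) ^ j = b powr (- \<theta> * real j)" for j
    using b by (simp add: powr_power mult.commute)
  ultimately have "(\<lambda>j. a 0 * b powr (- \<theta> * real j)) \<longlonglongrightarrow> a 0 * 0"
    by (intro tendsto_intros) simp
  then have "m \<le> a 0 * 0"
    using low decay by (intro LIMSEQ_le_const) (auto intro: order_trans)
  with m show False by simp
qed

theorem theorem1p2:
  fixes p \<sigma> C\<^sub>S :: real
  assumes "1 \<le> p" and "1 < \<sigma>" and "0 < C\<^sub>S"
  shows "\<exists>C\<^sub>D\<ge>1. \<forall>n\<ge>1. \<forall>\<mu> :: (nat \<Rightarrow> real) measure.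
    borel_measure_on_Rn n \<mu> \<longrightarrow>
    (\<forall>y\<in>Rn n. \<forall>R>0. 0 < emeasure \<mu> (Rn_ball n y R) \<and> emeasure \<mu> (Rn_ball n y R) < \<infinity>) \<longrightarrow>
    weak_sobolev n \<mu> p \<sigma> C\<^sub>S \<longrightarrow>
    doubling_with n \<mu> C\<^sub>D"
proof -
  \<comment> \<open>For the radii below, \<open>r\<^sub>j \<le> R\<close> and \<open>S = 2R\<close> bound \<open>4 S r\<^sub>j\<^sup>3 + r\<^sub>j\<^sup>4\<close> by \<open>9 R\<^sup>4\<close>, and
    \<open>(r\<^sub>j\<^sup>2 - r\<^sub>j\<^sub>+\<^sub>1\<^sup>2)\<^sup>2 \<ge> R\<^sup>4 / (16 * 4 ^ j)\<close>. Their quotient is \<open>144 * 4 ^ j\<close>, and raising it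
    to the power \<open>p \<sigma>\<close> yields \<open>A * b ^ j\<close>.\<close>
  define A where "A = (144 * C\<^sub>S) powr (p * \<sigma>)"
  define b where "b = 4 powr (p * \<sigma>)"
  define c where "c = A powr (- 1 / (\<sigma> - 1)) * b powr (- 1 / (\<sigma> - 1)\<^sup>2)"
  have ps: "0 < p * \<sigma>" using assms by simp
  have A: "0 < A" using assms by (simp add: A_def)
  have b: "1 < b" using ps by (simp add: b_def)
  have c: "0 < c" using A b by (simp add: c_def)
  have main: "measure \<mu> (Rn_ball n y (2 * R)) \<le> max 1 (1 / c) * measure \<mu> (Rn_ball n y R)"
    if bor: "borel_measure_on_Rn n \<mu>"
      and fin: "\<forall>y\<in>Rn n. \<forall>R>0. 0 < emeasure \<mu> (Rn_ball n y R) \<and> emeasure \<mu> (Rn_ball n y R) < \<infinity>"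
      and ws: "weak_sobolev n \<mu> p \<sigma> C\<^sub>S"
      and y: "y \<in> Rn n" and R: "0 < R"
    for n :: nat and \<mu> :: "(nat \<Rightarrow> real) measure" and y R
  proof -
    define m where "m = (\<lambda>r. measure \<mu> (Rn_ball n y r))"
    define r where "r = (\<lambda>j::nat. R / 2 + R / 2 / 2 ^ j)"
    define a where "a = (\<lambda>j. m (r j) / m (2 * R))"
    have mpos: "0 < m t" if "0 < t" for t
      using fin y that unfolding m_def by (simp add: measure_def enn2real_positive_iff)
    have rR: "R / 2 < r j" "r j \<le> R" for j
      using R by (auto simp: r_def field_simps)
    have step: "a (Suc j) \<le> A * b ^ j * a j powr \<sigma>" for j
    proof -
      have rs: "0 < r (Suc j)" "r (Suc j) < r j" "r j < 2 * R"
        using rR[of "Suc j"] rR[of j] R by (auto simp: r_def add_pos_pos divide_strict_left_mono)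
      have apos: "0 \<le> a j" "0 \<le> a (Suc j)" by (auto simp: a_def m_def)
      have "(R\<^sup>2 / (4 * 2 ^ j))\<^sup>2 \<le> ((r j)\<^sup>2 - (r (Suc j))\<^sup>2)\<^sup>2"
      proof (rule power_mono)
        have "R\<^sup>2 / (4 * 2 ^ j) = (r j - r (Suc j)) * R"
          by (simp add: r_def field_simps power2_eq_square)
        also have "\<dots> \<le> (r j - r (Suc j)) * (r j + r (Suc j))"
          using rR[of j] rR[of "Suc j"] rs by (intro mult_left_mono) auto
        finally show "R\<^sup>2 / (4 * 2 ^ j) \<le> (r j)\<^sup>2 - (r (Suc j))\<^sup>2"
          by (simp add: power2_eq_square algebra_simps)
      qed simp
      moreover have "(R\<^sup>2 / (4 * 2 ^ j))\<^sup>2 = R ^ 4 / (16 * 4 ^ j)"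
      proof -
        have "(2 ^ j)\<^sup>2 = (4 ^ j :: real)"
          by (simp add: power2_eq_square power_mult_distrib[symmetric])
        then show ?thesis by (simp add: power_divide power_mult_distrib)
      qed
      ultimately have "a (Suc j) powr (1 / (p * \<sigma>)) * (R ^ 4 / (16 * 4 ^ j))
          \<le> a (Suc j) powr (1 / (p * \<sigma>)) * ((r j)\<^sup>2 - (r (Suc j))\<^sup>2)\<^sup>2"
        by (intro mult_left_mono) auto
      also have "\<dots> \<le> C\<^sub>S * (4 * (2 * R) * r j ^ 3 + r j ^ 4) * a j powr (1 / p)"
        unfolding a_def m_def
        using weak_sobolev_imp_ball_ratio[OF assms bor _ ws y rs] fin y by simp
      also have "\<dots> \<le> C\<^sub>S * (4 * (2 * R) * R ^ 3 + R ^ 4) * a j powr (1 / p)"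
        using rR[of j] R assms
        by (intro mult_right_mono mult_left_mono add_mono power_mono) auto
      also have "\<dots> = 9 * C\<^sub>S * R ^ 4 * a j powr (1 / p)"
        by (simp add: power_numeral_reduce algebra_simps)
      finally have "a (Suc j) powr (1 / (p * \<sigma>)) \<le> 144 * C\<^sub>S * 4 ^ j * a j powr (1 / p)"
        using R by (simp add: field_simps)
      then have "(a (Suc j) powr (1 / (p * \<sigma>))) powr (p * \<sigma>)
          \<le> (144 * C\<^sub>S * 4 ^ j * a j powr (1 / p)) powr (p * \<sigma>)"
        using ps by (intro powr_mono2) auto
      moreover have "(a (Suc j) powr (1 / (p * \<sigma>))) powr (p * \<sigma>) = a (Suc j)"
        using assms apos by (simp add: powr_powr)
      moreover have "(4 ^ j :: real) powr (p * \<sigma>) = b ^ j"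
      proof -
        have "(4 ^ j :: real) powr (p * \<sigma>) = (4 powr real j) powr (p * \<sigma>)"
          by (simp add: powr_realpow)
        also have "\<dots> = b ^ j"
          unfolding b_def powr_powr by (simp add: powr_power mult.commute)
        finally show ?thesis .
      qed
      ultimately show ?thesis
        using assms apos by (simp add: powr_mult powr_powr A_def)
    qed
    have "m (R / 2) / m (2 * R) \<le> a j" for j
    proof -
      have "m (R / 2) \<le> m (r j)"
        unfolding m_def
      proof (rule measure_mono_fmeasurable)
        show "Rn_ball n y (R / 2) \<subseteq> Rn_ball n y (r j)"
          using rR[of j] by (auto simp: Rn_ball_def)
        show "Rn_ball n y (r j) \<in> fmeasurable \<mu>"
          using fin y rR[of j] R sets_Rn_ball[OF bor] by (intro fmeasurableI) auto
      qed (rule sets_Rn_ball[OF bor])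
      then show ?thesis using mpos[of "2 * R"] R by (simp add: a_def divide_right_mono)
    qed
    moreover have "0 < m (R / 2) / m (2 * R)" using mpos R by simp
    ultimately have "c < a 0"
      unfolding c_def by (intro superlinear_iteration_lower_bound[OF A b assms(2) _ _ step])
    then have "c * m (2 * R) < m R"
      using mpos[of "2 * R"] R by (simp add: a_def r_def field_simps)
    then have "m (2 * R) \<le> 1 / c * m R" using c by (simp add: field_simps)
    also have "\<dots> \<le> max 1 (1 / c) * m R"
      by (intro mult_right_mono) (auto simp: m_def)
    finally show ?thesis by (simp add: m_def)
  qed
  have "(1::real) \<le> max 1 (1 / c)" by simp
  with main show ?thesis unfolding doubling_with_def by blast
qed

end
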